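(* Let $G$ be a finitely generated group with a bound on the cardinalities of its finite normal subgroups. Suppose that there exists a quotient-closed set $\mathfrak{D}$ of left invariant pseudo-metrics on $G$ that contains an element $d_0$ such that $\delta_{G,d_0}=\inf_{d\in\mathfrak{D}}\delta_{G,d}$ and such that $G$ is growth tight with respect to $d_0$. Then $G$ is Hopfian.
   Context: A left invariant pseudo-metric $d$ on $G$ induces a left invariant pseudo-metric $\bar d$ on any quotient $G/\Gamma$ by $\bar d(g\Gamma,g'\Gamma):=d(g\Gamma,g'\Gamma)$, the distance (infimum) between the subsets $g\Gamma,g'\Gamma$ of $G$. For a group $H$ with left invariant pseudo-metric $d$, the growth exponent is $\delta_{H,d}:=\limsup_{r\to\infty}\frac1r\log\#\{g\in H\mid d(1,g)\leqslant r\}$. $G$ is growth tight with respect to $d$ if $\delta_{G,d}>\delta_{G/\Gamma,\bar d}$ for every infinite normal subgroup $\Gamma$ of $G$. A set $\mathfrak{D}$ of pseudo-metrics on $G$ is quotient-closed if, whenever $\Gamma$ is a normal subgroup of $G$ such that there exists an isomorphism $\phi\colon G\to G/\Gamma$, then for every $d\in\mathfrak{D}$ the pseudo-metric on $G$ obtained by pulling back via $\phi$ the pseudo-metric on $G/\Gamma$ induced by $d$ is also in $\mathfrak{D}$. $G$ is Hopfian if no proper quotient of $G$ (i.e. quotient by a nontrivial normal subgroup) is isomorphic to $G$. *)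

theory Defs
  imports "HOL-Algebra.Generated_Groups" "HOL-Library.Extended_Real"
begin

definition finitely_generated_group :: "('a, 'b) monoid_scheme \<Rightarrow> bool" where
  "finitely_generated_group G \<longleftrightarrow>
     group G \<and> (\<exists>S. finite S \<and> S \<subseteq> carrier G \<and> generate G S = carrier G)"

definition hopfian :: "('a, 'b) monoid_scheme \<Rightarrow> bool" where
  "hopfian G \<longleftrightarrow> (\<forall>N. N \<lhd> G \<and> N \<noteq> {\<one>\<^bsub>G\<^esub>} \<longrightarrow> \<not> (G Mod N \<cong> G))"

text \<open>Pseudo-metrics are extensional functions, so that two of them are equal
  as soon as they agree on the carrier.\<close>

definition left_invariant_pseudo_metric ::
  "('a, 'b) monoid_scheme \<Rightarrow> ('a \<Rightarrow> 'a \<Rightarrow> real) \<Rightarrow> bool" where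
  "left_invariant_pseudo_metric G d \<longleftrightarrow>
     d \<in> carrier G \<rightarrow>\<^sub>E (carrier G \<rightarrow>\<^sub>E {0..}) \<and>
     (\<forall>x\<in>carrier G. d x x = 0) \<and>
     (\<forall>x\<in>carrier G. \<forall>y\<in>carrier G. d x y = d y x) \<and>
     (\<forall>x\<in>carrier G. \<forall>y\<in>carrier G. \<forall>z\<in>carrier G. d x z \<le> d x y + d y z) \<and>
     (\<forall>g\<in>carrier G. \<forall>x\<in>carrier G. \<forall>y\<in>carrier G. d (g \<otimes>\<^bsub>G\<^esub> x) (g \<otimes>\<^bsub>G\<^esub> y) = d x y)"

definition subset_distance :: "('a \<Rightarrow> 'a \<Rightarrow> real) \<Rightarrow> 'a set \<Rightarrow> 'a set \<Rightarrow> real" where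
  "subset_distance d A B = (INF (a, b)\<in>A \<times> B. d a b)"

text \<open>The elements of \<^term>\<open>carrier (G Mod N)\<close> are right cosets, which are also the
  left cosets when \<open>N\<close> is normal.\<close>

definition quotient_pseudo_metric ::
  "('a, 'b) monoid_scheme \<Rightarrow> 'a set \<Rightarrow> ('a \<Rightarrow> 'a \<Rightarrow> real) \<Rightarrow> 'a set \<Rightarrow> 'a set \<Rightarrow> real" where
  "quotient_pseudo_metric G N d =
     (\<lambda>A\<in>carrier (G Mod N). \<lambda>B\<in>carrier (G Mod N). subset_distance d A B)"

definition pullback_pseudo_metric ::
  "('a, 'b) monoid_scheme \<Rightarrow> ('a \<Rightarrow> 'c) \<Rightarrow> ('c \<Rightarrow> 'c \<Rightarrow> real) \<Rightarrow> 'a \<Rightarrow> 'a \<Rightarrow> real" where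
  "pullback_pseudo_metric G \<phi> d = (\<lambda>x\<in>carrier G. \<lambda>y\<in>carrier G. d (\<phi> x) (\<phi> y))"

definition quotient_closed ::
  "('a, 'b) monoid_scheme \<Rightarrow> ('a \<Rightarrow> 'a \<Rightarrow> real) set \<Rightarrow> bool" where
  "quotient_closed G D \<longleftrightarrow>
     (\<forall>N \<phi>. N \<lhd> G \<and> \<phi> \<in> iso G (G Mod N) \<longrightarrow>
        (\<forall>d\<in>D. pullback_pseudo_metric G \<phi> (quotient_pseudo_metric G N d) \<in> D))"

text \<open>Balls may be infinite, in which case the logarithm of the cardinality, and hence
  possibly the growth exponent, is \<open>\<infinity>\<close>.\<close>

definition log_cardinality :: "'a set \<Rightarrow> ereal" where
  "log_cardinality S = (if finite S then ereal (ln (real (card S))) else \<infinity>)"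

definition growth_exponent :: "('a, 'b) monoid_scheme \<Rightarrow> ('a \<Rightarrow> 'a \<Rightarrow> real) \<Rightarrow> ereal" where
  "growth_exponent G d =
     Limsup at_top (\<lambda>r::real. ereal (1 / r) * log_cardinality {g \<in> carrier G. d \<one>\<^bsub>G\<^esub> g \<le> r})"

definition growth_tight :: "('a, 'b) monoid_scheme \<Rightarrow> ('a \<Rightarrow> 'a \<Rightarrow> real) \<Rightarrow> bool" where
  "growth_tight G d \<longleftrightarrow>
     (\<forall>N. N \<lhd> G \<and> infinite N \<longrightarrow>
        growth_exponent G d > growth_exponent (G Mod N) (quotient_pseudo_metric G N d))"

end

theory Submission
  imports Defs
begin

text \<open>A quotient of \<open>G\<close> isomorphic to \<open>G\<close> cannot have smaller growth exponent than the
  minimiser \<open>d\<^sub>0\<close>, because \<open>D\<close> is quotient-closed; so growth tightness makes the kernel of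
  every surjective endomorphism of \<open>G\<close> finite. If a surjective endomorphism had a nontrivial
  kernel, the kernels of its iterates would form a strictly increasing sequence of finite normal
  subgroups, contradicting the bound on their cardinalities.\<close>

text \<open>An isomorphism sends identity to identity, so it restricts to a bijection between the
  balls of radius \<open>r\<close> about the identities. Nothing about \<open>d\<close> itself
  enters.\<close>

lemma growth_exponent_pullback:
  assumes "group G" "group H" "\<phi> \<in> iso G H"
  shows "growth_exponent G (pullback_pseudo_metric G \<phi> d) = growth_exponent H d"
proof -
  interpret group_hom G H \<phi>
    using assms by (simp add: group_hom_def group_hom_axioms_def iso_def)
  have bij: "bij_betw \<phi> (carrier G) (carrier H)"
    using assms(3) by (simp add: iso_def)
  define B where "B r = {g \<in> carrier G. pullback_pseudo_metric G \<phi> d \<one>\<^bsub>G\<^esub> g \<le> r}" for r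
  define C where "C r = {h \<in> carrier H. d \<one>\<^bsub>H\<^esub> h \<le> r}" for r
  have "bij_betw \<phi> (B r) (C r)" for r
  proof (rule bij_betw_subset[OF bij])
    have "B r = {g \<in> carrier G. d \<one>\<^bsub>H\<^esub> (\<phi> g) \<le> r}"
      by (auto simp: B_def pullback_pseudo_metric_def)
    moreover have "C r = {h \<in> \<phi> ` carrier G. d \<one>\<^bsub>H\<^esub> h \<le> r}"
      using bij by (simp add: C_def bij_betw_def)
    ultimately show "\<phi> ` B r = C r"
      by (simp only:) auto
  qed (simp add: B_def)
  \<comment> \<open>Balls may be infinite; the bijection transfers finiteness as well as
    cardinality, so both cases of \<open>log_cardinality\<close> agree.\<close>
  then have "log_cardinality (B r) = log_cardinality (C r)" for r
    by (simp add: log_cardinality_def bij_betw_finite[of \<phi> "B r" "C r"]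
        bij_betw_same_card[of \<phi> "B r" "C r"])
  then show ?thesis
    by (simp add: growth_exponent_def B_def C_def)
qed

text \<open>The quotient pseudo-metric pulled back along \<open>\<phi>\<close> competes with
  \<open>d0\<close> in \<open>D\<close> and has the growth exponent of the quotient; for infinite
  \<open>N\<close>, tightness would put it strictly below the minimum.\<close>

lemma growth_tight_minimiser_finite_kernel:
  assumes "quotient_closed G D" "d0 \<in> D"
    and "growth_exponent G d0 = (INF d\<in>D. growth_exponent G d)"
    and "growth_tight G d0"
    and "N \<lhd> G" "\<phi> \<in> iso G (G Mod N)"
  shows "finite N"
proof (rule ccontr)
  assume "infinite N"
  interpret normal N G by fact
  let ?q = "quotient_pseudo_metric G N d0"
  have "pullback_pseudo_metric G \<phi> ?q \<in> D"
    using assms by (auto simp: quotient_closed_def)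
  then have "growth_exponent G d0 \<le> growth_exponent G (pullback_pseudo_metric G \<phi> ?q)"
    unfolding assms(3) by (rule INF_lower)
  also have "\<dots> = growth_exponent (G Mod N) ?q"
    by (rule growth_exponent_pullback[OF is_group factorgroup_is_group assms(6)])
  also have "\<dots> < growth_exponent G d0"
    using assms(4,5) \<open>infinite N\<close> by (auto simp: growth_tight_def)
  finally show False by simp
qed

lemma hom_funpow: "f \<in> hom G G \<Longrightarrow> (f ^^ n) \<in> hom G G"
  by (induction n) (auto simp: hom_def Pi_def)

lemma image_funpow_eq: "f ` A = A \<Longrightarrow> (f ^^ n) ` A = A"
  by (induction n) (simp_all only: funpow.simps image_comp[symmetric] image_id id_apply)

text \<open>Since \<open>f ^^ n\<close> is onto, a nontrivial \<open>x\<close> in the kernel of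
  \<open>f\<close> has a preimage \<open>y\<close> under it; one more application of
  \<open>f\<close> kills \<open>y\<close>, but \<open>f ^^ n\<close> does not.\<close>

lemma kernel_funpow_psubset:
  assumes "group G" "f \<in> hom G G" "f ` carrier G = carrier G" "kernel G G f \<noteq> {\<one>\<^bsub>G\<^esub>}"
  shows "kernel G G (f ^^ n) \<subset> kernel G G (f ^^ Suc n)"
proof
  interpret group_hom G G f
    using assms by (simp add: group_hom_def group_hom_axioms_def)
  show "kernel G G (f ^^ n) \<subseteq> kernel G G (f ^^ Suc n)"
    by (auto simp: kernel_def)
  obtain x where x: "x \<in> carrier G" "f x = \<one>\<^bsub>G\<^esub>" "x \<noteq> \<one>\<^bsub>G\<^esub>"
    using assms(4) by (auto simp: kernel_def)
  then obtain y where "y \<in> carrier G" "(f ^^ n) y = x"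
    using image_funpow_eq[OF assms(3), of n] by (metis imageE)
  then have "y \<in> kernel G G (f ^^ Suc n)" "y \<notin> kernel G G (f ^^ n)"
    using x by (auto simp: kernel_def)
  then show "kernel G G (f ^^ n) \<noteq> kernel G G (f ^^ Suc n)"
    by blast
qed

theorem proposition0p4:
  fixes G :: "('a, 'b) monoid_scheme"
    and D :: "('a \<Rightarrow> 'a \<Rightarrow> real) set"
    and d0 :: "'a \<Rightarrow> 'a \<Rightarrow> real"
  assumes "finitely_generated_group G"
    and "\<exists>B::nat. \<forall>N. N \<lhd> G \<and> finite N \<longrightarrow> card N \<le> B"
    and "\<forall>d\<in>D. left_invariant_pseudo_metric G d"
    and "quotient_closed G D"
    and "d0 \<in> D"
    and "growth_exponent G d0 = (INF d\<in>D. growth_exponent G d)"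
    and "growth_tight G d0"
  shows "hopfian G"
  unfolding hopfian_def
proof (intro allI impI notI)
  fix N assume N: "N \<lhd> G \<and> N \<noteq> {\<one>\<^bsub>G\<^esub>}" and "G Mod N \<cong> G"
  then obtain \<psi> where \<psi>: "\<psi> \<in> iso (G Mod N) G"
    by (auto simp: is_iso_def)
  interpret normal N G using N by simp
  \<comment> \<open>Projection followed by the assumed isomorphism: a surjective endomorphism of
    \<open>G\<close> that kills \<open>N\<close>.\<close>
  define f where "f = \<psi> \<circ> (\<lambda>x. N #>\<^bsub>G\<^esub> x)"
  have f_hom: "f \<in> hom G G"
    unfolding f_def using \<psi> by (intro Group.hom_compose[OF r_coset_hom_Mod]) (simp add: iso_def)
  have f_surj: "f ` carrier G = carrier G"
  proof -
    have "(\<lambda>x. N #>\<^bsub>G\<^esub> x) ` carrier G = carrier (G Mod N)"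
      by (auto simp: FactGroup_def RCOSETS_def)
    moreover have "\<psi> ` carrier (G Mod N) = carrier G"
      using \<psi> by (simp add: iso_def bij_betw_def)
    ultimately show ?thesis
      by (simp only: f_def image_comp[symmetric])
  qed
  interpret \<psi>: group_hom "G Mod N" G \<psi>
    using \<psi> by (simp add: group_hom_def group_hom_axioms_def iso_def factorgroup_is_group is_group)
  have "N \<subseteq> kernel G G f"
    using \<psi>.hom_one by (auto simp: kernel_def f_def rcos_const)
  \<comment> \<open>\<open>N\<close> contains the identity and is not trivial, so the inclusion
    suffices.\<close>
  then have f_kernel: "kernel G G f \<noteq> {\<one>\<^bsub>G\<^esub>}"
    using N one_closed by auto
  have ker_normal: "kernel G G (f ^^ n) \<lhd> G" and fin: "finite (kernel G G (f ^^ n))" for n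
  proof -
    interpret h: group_hom G G "f ^^ n"
      using hom_funpow[OF f_hom] by (simp add: group_hom_def group_hom_axioms_def is_group)
    show nm: "kernel G G (f ^^ n) \<lhd> G"
      by (rule h.normal_kernel)
    have "G Mod kernel G G (f ^^ n) \<cong> G"
      by (rule h.FactGroup_iso[OF image_funpow_eq[OF f_surj]])
    \<comment> \<open>The first isomorphism theorem gives a map out of the quotient; pulling back
      needs one from \<open>G\<close> onto it.\<close>
    then have "G \<cong> G Mod kernel G G (f ^^ n)"
      by (rule group.iso_sym[OF normal.factorgroup_is_group[OF nm]])
    then show "finite (kernel G G (f ^^ n))"
      using growth_tight_minimiser_finite_kernel[OF assms(4-7) nm] by (auto simp: is_iso_def)
  qed
  have "strict_mono (\<lambda>n. card (kernel G G (f ^^ n)))"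
    unfolding strict_mono_Suc_iff
    using psubset_card_mono[OF fin kernel_funpow_psubset[OF is_group f_hom f_surj f_kernel]]
    by blast
  \<comment> \<open>A strictly increasing sequence of naturals dominates its index, so the term at
    \<open>Suc B\<close> exceeds any proposed bound \<open>B\<close>.\<close>
  then have "n \<le> card (kernel G G (f ^^ n))" for n
    by (rule strict_mono_imp_increasing)
  moreover obtain B where "card (kernel G G (f ^^ n)) \<le> B" for n
    using assms(2) ker_normal fin by blast
  ultimately show False
    by (meson le_trans not_less_eq_eq)
qed

end
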